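(* Let $a_{2,1},a_{2,2},p_{1,1},g_{1,1},p_{3,1},p_{3,2},p_{3,3}\in\mathbb{R}$ be such that all denominators below are nonzero, and set $$g_{3,1}=g_{3,2}=g_{3,3}=1,\qquad g_{2,1}=g_{2,2}=\frac{2(3a_{2,1}g_{1,1}p_{1,1}-a_{2,1}p_{1,1}-2g_{1,1})}{3a_{2,1}p_{1,1}-4},$$ $$a_{1,1}=\frac{a_{2,1}}2,\qquad p_{2,1}=0,$$ $$p_{2,2}=-\frac{2\left(9a_{1,1}a_{2,1}a_{2,2}p_{1,1}p_{2,1}-6a_{1,1}a_{2,1}p_{1,1}-12a_{1,1}a_{2,2}p_{2,1}+8a_{1,1}+6a_{2,1}^2p_{1,1}-4a_{2,1}\right)}{3a_{1,1}a_{2,2}(3a_{2,1}p_{1,1}-4)},$$ $$b_1=\frac1{p_{1,1}},\qquad b_2=-\frac{a_{2,2}(3a_{2,1}p_{1,1}-4)}{2a_{2,1}^2p_{1,1}^2},\qquad b_3=-\frac{3a_{2,1}p_{1,1}-4}{a_{2,1}^2p_{1,1}^2(6p_{3,1}+3p_{3,2}+p_{3,3})}.$$ Then the three-stage EPIRK-$W$ method (defined in the context) with these coefficients has order three as a $W$-method. Moreover, for every $\widehat b_3\in\mathbb{R}$, the embedded method obtained by keeping all $a,g,p$ coefficients and replacing the weights $(b_1,b_2,b_3)$ by $(\widehat b_1,\widehat b_2,\widehat b_3)$ with $\widehat b_1=b_1$ and $\widehat b_2=b_2$ has order (at least) two as a $W$-method.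
   Context: Let $f:\mathbb{R}^N\to\mathbb{R}^N$ be smooth and consider $y'=f(y)$. Let $y_n\in\mathbb{R}^N$, step size $h>0$, and let $\mathbf{A}_n\in\mathbb{R}^{N\times N}$ be an arbitrary matrix independent of $h$ (an arbitrary approximation of the Jacobian $\mathbf{J}_n=f'(y_n)$). For $k\ge1$, $\varphi_k(z)=\sum_{i\ge0}\frac{z^i}{(i+k)!}$ (applied to matrices as an entire function), and $\psi_j(z)=\sum_{k=1}^{j}p_{j,k}\varphi_k(z)$ for $j=1,2,3$. Put $r(y)=f(y)-f(y_n)-\mathbf{A}_n(y-y_n)$. With $Y_0=y_n$, forward differences are $\Delta^{(1)}r(Y_i)=r(Y_{i+1})-r(Y_i)$ and $\Delta^{(j)}r(Y_i)=\Delta^{(j-1)}r(Y_{i+1})-\Delta^{(j-1)}r(Y_i)$, and $\Delta^{(j)}r(y_n)=\Delta^{(j)}r(Y_0)$. The three-stage EPIRK-$W$ method with coefficients $a_{i,j},b_j,g_{i,j},p_{j,k}$ is $$Y_1=y_n+a_{1,1}\psi_1(g_{1,1}h\mathbf{A}_n)hf(y_n),$$ $$Y_2=y_n+a_{2,1}\psi_1(g_{2,1}h\mathbf{A}_n)hf(y_n)+a_{2,2}\psi_2(g_{2,2}h\mathbf{A}_n)h\Delta^{(1)}r(y_n),$$ $$y_{n+1}=y_n+b_1\psi_1(g_{3,1}h\mathbf{A}_n)hf(y_n)+b_2\psi_2(g_{3,2}h\mathbf{A}_n)h\Delta^{(1)}r(y_n)+b_3\psi_3(g_{3,3}h\mathbf{A}_n)h\Delta^{(2)}r(y_n).$$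 The method has order $p$ as a $W$-method if for every $N$, every smooth $f$, every $y_n$ and every matrix $\mathbf{A}_n$ (independent of $h$), $y_{n+1}-y(t_n+h)=O(h^{p+1})$ as $h\to0$, where $y(\cdot)$ is the exact solution with $y(t_n)=y_n$. *)

theory Defs
  imports "HOL-Analysis.Analysis" "HOL-Library.Landau_Symbols"
begin

text \<open>Continuous \<open>k\<close>-fold differentiability on the whole space, expressed through iterated
  directional derivatives \<open>x \<mapsto> f'(x) v\<close>.\<close>

fun k_times_differentiable ::
    "nat \<Rightarrow> ('a::real_normed_vector \<Rightarrow> 'b::real_normed_vector) \<Rightarrow> bool" where
  "k_times_differentiable 0 f \<longleftrightarrow> continuous_on UNIV f"
| "k_times_differentiable (Suc k) f \<longleftrightarrow>
     (\<forall>x. f differentiable (at x)) \<and>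
     (\<forall>v. k_times_differentiable k (\<lambda>x. frechet_derivative f (at x) v))"

definition smooth :: "('a::real_normed_vector \<Rightarrow> 'b::real_normed_vector) \<Rightarrow> bool" where
  "smooth f \<longleftrightarrow> (\<forall>k. k_times_differentiable k f)"

text \<open>On type \<open>real^'n^'n\<close> the operations \<open>*\<close> and \<open>^\<close> are entrywise, so matrix powers
  are iterated with \<open>**\<close>.\<close>

primrec mat_power :: "real^'n^'n \<Rightarrow> nat \<Rightarrow> real^'n^'n" where
  "mat_power Z 0 = mat 1"
| "mat_power Z (Suc i) = Z ** mat_power Z i"

definition phi :: "nat \<Rightarrow> real^'n^'n \<Rightarrow> real^'n^'n" where
  "phi k Z = (\<Sum>i. (1 / fact (i + k)) *\<^sub>R mat_power Z i)"

definition psi :: "(nat \<Rightarrow> nat \<Rightarrow> real) \<Rightarrow> nat \<Rightarrow> real^'n^'n \<Rightarrow> real^'n^'n" where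
  "psi p j Z = (\<Sum>k=1..j. p j k *\<^sub>R phi k Z)"

definition rem :: "(real^'n \<Rightarrow> real^'n) \<Rightarrow> real^'n^'n \<Rightarrow> real^'n \<Rightarrow> real^'n \<Rightarrow> real^'n" where
  "rem f A yn y = f y - f yn - A *v (y - yn)"

primrec fdiff :: "nat \<Rightarrow> (nat \<Rightarrow> 'a::ab_group_add) \<Rightarrow> nat \<Rightarrow> 'a" where
  "fdiff 0 s i = s i"
| "fdiff (Suc j) s i = fdiff j s (Suc i) - fdiff j s i"

text \<open>The internal stages as a sequence \<open>Y 0 = y\<^sub>n, Y 1, Y 2\<close> (values at indices above 2 are
  irrelevant). Coefficients are functions of their indices; only the indices occurring in the
  scheme are used.\<close>

definition epirkw_stages ::
    "(nat \<Rightarrow> nat \<Rightarrow> real) \<Rightarrow> (nat \<Rightarrow> nat \<Rightarrow> real) \<Rightarrow> (nat \<Rightarrow> nat \<Rightarrow> real) \<Rightarrow>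
     (real^'n \<Rightarrow> real^'n) \<Rightarrow> real^'n^'n \<Rightarrow> real^'n \<Rightarrow> real \<Rightarrow> nat \<Rightarrow> real^'n" where
  "epirkw_stages a g p f A yn h =
     (let r = rem f A yn;
          Y = (\<lambda>_. yn);
          Y = Y(1 := yn + a 1 1 *\<^sub>R (psi p 1 ((g 1 1 * h) *\<^sub>R A) *v (h *\<^sub>R f yn)));
          Y = Y(2 := yn + a 2 1 *\<^sub>R (psi p 1 ((g 2 1 * h) *\<^sub>R A) *v (h *\<^sub>R f yn))
                        + a 2 2 *\<^sub>R (psi p 2 ((g 2 2 * h) *\<^sub>R A) *v (h *\<^sub>R fdiff 1 (r \<circ> Y) 0)))
      in Y)"

definition epirkw_step ::
    "(nat \<Rightarrow> nat \<Rightarrow> real) \<Rightarrow> (nat \<Rightarrow> real) \<Rightarrow> (nat \<Rightarrow> nat \<Rightarrow> real) \<Rightarrow> (nat \<Rightarrow> nat \<Rightarrow> real) \<Rightarrow>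
     (real^'n \<Rightarrow> real^'n) \<Rightarrow> real^'n^'n \<Rightarrow> real^'n \<Rightarrow> real \<Rightarrow> real^'n" where
  "epirkw_step a b g p f A yn h =
     (let r = rem f A yn;
          Y = epirkw_stages a g p f A yn h
      in yn + b 1 *\<^sub>R (psi p 1 ((g 3 1 * h) *\<^sub>R A) *v (h *\<^sub>R f yn))
            + b 2 *\<^sub>R (psi p 2 ((g 3 2 * h) *\<^sub>R A) *v (h *\<^sub>R fdiff 1 (r \<circ> Y) 0))
            + b 3 *\<^sub>R (psi p 3 ((g 3 3 * h) *\<^sub>R A) *v (h *\<^sub>R fdiff 2 (r \<circ> Y) 0)))"

text \<open>Order \<open>q\<close> as a W-method for systems of dimension \<open>CARD('n)\<close>; the quantification over all
  dimensions is the one over the type variable \<open>'n\<close>. The exact solution need only exist on some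
  interval to the right of \<open>t\<^sub>n\<close>.\<close>

definition epirkw_order ::
    "'n::finite itself \<Rightarrow>
     (nat \<Rightarrow> nat \<Rightarrow> real) \<Rightarrow> (nat \<Rightarrow> real) \<Rightarrow> (nat \<Rightarrow> nat \<Rightarrow> real) \<Rightarrow> (nat \<Rightarrow> nat \<Rightarrow> real) \<Rightarrow>
     nat \<Rightarrow> bool" where
  "epirkw_order N a b g p q \<longleftrightarrow>
     (\<forall>(f :: real^'n \<Rightarrow> real^'n) (A :: real^'n^'n) yn y tn T.
        smooth f \<longrightarrow> T > 0 \<longrightarrow> y tn = yn \<longrightarrow>
        (\<forall>t\<in>{tn..tn + T}. (y has_vector_derivative f (y t)) (at t within {tn..tn + T})) \<longrightarrow>
        (\<lambda>h. norm (epirkw_step a b g p f A yn h - y (tn + h))) \<in> O[at_right 0](\<lambda>h. h ^ (q + 1)))"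

end

theory Submission
  imports Defs
begin

text \<open>Write \<open>F = f(y\<^sub>n)\<close>, \<open>J = f'(y\<^sub>n)\<close>, \<open>B = f''(y\<^sub>n)\<close> and \<open>K = J - A\<close>. Both the exact solution and
the numerical step have an expansion \<open>y\<^sub>n + h s\<^sub>1 + h\<^sup>2 s\<^sub>2 + h\<^sup>3 s\<^sub>3 + O(h\<^sup>4)\<close>, and the theorem holds
because the vectors \<open>s\<^sub>i\<close> agree.

For the exact solution these vectors are \<open>F\<close>, \<open>JF/2\<close> and \<open>(JJF + B(F,F))/6\<close>
(\<open>exact_solution_expansion\<close>). For the numerical step (\<open>step_expansion\<close>) they are combinations of
the words \<open>F\<close>; \<open>AF, KF\<close>; \<open>AAF, AKF, KAF, KKF, B(F,F)\<close>, whose weights are polynomials in the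
coefficients of the method and in the Taylor coefficients \<open>psi_coeff p j i\<close> of \<open>\<psi>\<^sub>j\<close>. Since
\<open>J = A + K\<close>, one has \<open>JF = AF + KF\<close> and \<open>JJF = AAF + AKF + KAF + KKF\<close>. So the step has order
three, for every matrix \<open>A\<close>, as soon as the weights are \<open>1\<close>; \<open>1/2, 1/2\<close>;
\<open>1/6, 1/6, 1/6, 1/6, 1/6\<close> (\<open>local_error_order_three\<close>), and order two as soon as the first three
weights are right (\<open>local_error_order_two\<close>). With \<open>x = a\<^sub>2\<^sub>1 p\<^sub>1\<^sub>1\<close> these conditions on the given
coefficients are rational identities in \<open>x\<close> and \<open>g\<^sub>1\<^sub>1\<close>. The choice \<open>a\<^sub>1\<^sub>1 = a\<^sub>2\<^sub>1/2\<close> makes the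
\<open>h\<close>-term of \<open>\<Delta>\<^sup>(\<^sup>2\<^sup>)r(y\<^sub>n)\<close> vanish. Hence the term weighted by \<open>b\<^sub>3\<close> is \<open>O(h\<^sup>3)\<close>, which is why the
embedded method keeps order two for every \<open>b\<^sub>3\<close>.

The expansions rest on three analytic facts: a second-order Taylor formula for \<open>f\<close> with a remainder
that is uniform in the direction (\<open>taylor_second_order\<close>), the truncation error of the matrix series
\<open>\<phi>\<^sub>k\<close> (\<open>phi_expansion\<close>), and the gain of one power of \<open>h\<close> under integration
(\<open>vanishes_mean_value\<close>), which lets the expansion of the exact solution be bootstrapped from the
differential equation.\<close>

section \<open>Order of vanishing at the left end point of the step\<close>

text \<open>Landau symbols compare functions with values in a normed field. For vector-valued expansions the
order of vanishing of the norm is used instead; an expansion \<open>X = P + O(h\<^sup>m)\<close> is expressed as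
\<open>vanishes m (\<lambda>h. X h - P h)\<close>.\<close>
definition vanishes :: "nat \<Rightarrow> (real \<Rightarrow> 'a::real_normed_vector) \<Rightarrow> bool" where
  "vanishes m X \<longleftrightarrow> (\<lambda>h. norm (X h)) \<in> O[at_right 0](\<lambda>h. h ^ m)"

lemma vanishes_zero [simp]: "vanishes m (\<lambda>h. 0)"
  by (simp add: vanishes_def)

lemma vanishes_const [simp]: "vanishes 0 (\<lambda>h. v)"
  by (simp add: vanishes_def)

lemma vanishes_add:
  assumes "vanishes m X" "vanishes m Y"
  shows "vanishes m (\<lambda>h. X h + Y h)"
proof -
  have "(\<lambda>h. norm (X h + Y h)) \<in> O[at_right 0](\<lambda>h. norm (X h) + norm (Y h))"
    by (rule bigoI[of _ 1]) (auto intro!: always_eventually norm_triangle_ineq)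
  moreover have "(\<lambda>h. norm (X h) + norm (Y h)) \<in> O[at_right 0](\<lambda>h. h ^ m)"
    using assms unfolding vanishes_def by (rule sum_in_bigo)
  ultimately show ?thesis
    unfolding vanishes_def by (rule landau_o.big_trans)
qed

lemma vanishes_bounded_linear:
  assumes "bounded_linear L" "vanishes m X"
  shows "vanishes m (\<lambda>h. L (X h))"
proof -
  obtain K where K: "\<And>x. norm (L x) \<le> norm x * K"
    using bounded_linear.bounded[OF assms(1)] by blast
  have "(\<lambda>h. norm (L (X h))) \<in> O[at_right 0](\<lambda>h. norm (X h))"
    by (rule bigoI[of _ K]) (use K in \<open>auto simp: mult.commute\<close>)
  then show ?thesis
    using assms(2) unfolding vanishes_def by (rule landau_o.big_trans)
qed

lemma vanishes_minus: "vanishes m X \<Longrightarrow> vanishes m (\<lambda>h. - X h)"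
  by (simp add: vanishes_def)

lemma vanishes_diff:
  "vanishes m X \<Longrightarrow> vanishes m Y \<Longrightarrow> vanishes m (\<lambda>h. X h - Y h)"
  using vanishes_add[OF _ vanishes_minus] by fastforce

lemma vanishes_bounded_bilinear:
  assumes "bounded_bilinear B" "vanishes m X" "vanishes n Y"
  shows "vanishes (m + n) (\<lambda>h. B (X h) (Y h))"
proof -
  obtain K where K: "\<And>x y. norm (B x y) \<le> norm x * norm y * K"
    using bounded_bilinear.bounded[OF assms(1)] by blast
  have "(\<lambda>h. norm (B (X h) (Y h))) \<in> O[at_right 0](\<lambda>h. norm (X h) * norm (Y h))"
    by (rule bigoI[of _ K]) (use K in \<open>auto simp: mult.commute\<close>)
  moreover have "(\<lambda>h. norm (X h) * norm (Y h)) \<in> O[at_right 0](\<lambda>h. h ^ m * h ^ n)"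
    using assms(2,3) unfolding vanishes_def by (rule landau_o.big_mult)
  ultimately show ?thesis
    unfolding vanishes_def power_add by (rule landau_o.big_trans)
qed

lemma vanishes_power: "vanishes m (\<lambda>h::real. h ^ m)"
  unfolding vanishes_def by (rule bigoI[of _ 1]) (simp add: norm_power)

lemma vanishes_power_scaleR:
  assumes "vanishes m X" shows "vanishes (k + m) (\<lambda>h. h ^ k *\<^sub>R X h)"
  using vanishes_bounded_bilinear[OF bounded_bilinear_scaleR vanishes_power assms] .

lemma vanishes_step_scaleR:
  assumes "vanishes m X" shows "vanishes (Suc m) (\<lambda>h. h *\<^sub>R X h)"
  using vanishes_power_scaleR[OF assms, of 1] by simp

lemma vanishes_scaleR: "vanishes m X \<Longrightarrow> vanishes m (\<lambda>h. c *\<^sub>R X h)"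
  by (rule vanishes_bounded_linear[OF bounded_linear_scaleR_right])

lemma vanishes_sum:
  "(\<And>i. i \<in> I \<Longrightarrow> vanishes m (X i)) \<Longrightarrow> vanishes m (\<lambda>h. \<Sum>i\<in>I. X i h)"
  by (induction I rule: infinite_finite_induct) (auto intro: vanishes_add)

lemma vanishes_mono:
  assumes "vanishes m X" "n \<le> m"
  shows "vanishes n X"
proof -
  have "(\<lambda>h::real. h ^ m) \<in> O[at_right 0](\<lambda>h. h ^ n)"
  proof (rule bigoI[of _ 1])
    have "eventually (\<lambda>h::real. 0 < h \<and> h < 1) (at_right 0)"
      by (simp add: eventually_at_right_less eventually_at_right_field eventually_conj)
         (use zero_less_one in blast)
    then show "\<forall>\<^sub>F h::real in at_right 0. norm (h ^ m) \<le> 1 * norm (h ^ n)"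
      by eventually_elim (use assms(2) in \<open>auto simp: intro!: power_decreasing\<close>)
  qed
  with assms(1) show ?thesis
    unfolding vanishes_def by (rule landau_o.big_trans)
qed

lemma vanishes_monomial: "n \<le> m \<Longrightarrow> vanishes n (\<lambda>h. h ^ m *\<^sub>R v)"
  using vanishes_mono[OF vanishes_power_scaleR[OF vanishes_const]] by fastforce

lemma vanishes_tendsto:
  assumes "vanishes (Suc m) X"
  shows "(X \<longlongrightarrow> 0) (at_right 0)"
proof -
  have "vanishes 1 X"
    using assms by (rule vanishes_mono) simp
  then obtain c where "eventually (\<lambda>h. norm (norm (X h)) \<le> c * norm (h ^ 1)) (at_right 0)"
    unfolding vanishes_def by (elim landau_o.bigE)
  then have *: "eventually (\<lambda>h. norm (X h) \<le> c * \<bar>h\<bar>) (at_right 0)"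
    by simp
  have "((\<lambda>h::real. c * \<bar>h\<bar>) \<longlongrightarrow> c * \<bar>0\<bar>) (at_right 0)"
    by (intro tendsto_intros)
  then show ?thesis
    by (intro Lim_null_comparison[OF *]) simp
qed

text \<open>Integration gains one power of \<open>h\<close>. The mean value inequality only evaluates \<open>E'\<close> in the open
interval, so the one-sided bound expressed by \<open>vanishes\<close> suffices.\<close>
lemma vanishes_mean_value:
  fixes E :: "real \<Rightarrow> 'a::real_inner"
  assumes "0 < T" "E 0 = 0"
    and der: "\<And>s. s \<in> {0..T} \<Longrightarrow> (E has_vector_derivative E' s) (at s within {0..T})"
    and van: "vanishes m E'"
  shows "vanishes (Suc m) E"
proof -
  obtain c where c: "c > 0"
    and ev: "eventually (\<lambda>s. norm (norm (E' s)) \<le> c * norm (s ^ m)) (at_right 0)"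
    using van unfolding vanishes_def by (elim landau_o.bigE)
  then obtain e where e: "e > 0"
    and bound: "\<And>s. 0 < s \<Longrightarrow> s < e \<Longrightarrow> norm (E' s) \<le> c * s ^ m"
    by (auto simp: eventually_at_right_field abs_of_pos)
  have "norm (E h) \<le> c * h ^ Suc m" if h: "0 < h" "h < min e T" for h
  proof -
    have cont: "continuous_on {0..h} E"
      using that der by (intro continuous_on_vector_derivative[of _ _ E'])
        (auto intro: has_vector_derivative_within_subset[of E _ _ "{0..T}"])
    have "(E has_derivative (\<lambda>u. u *\<^sub>R E' s)) (at s)" if "0 < s" "s < h" for s
    proof -
      have "at s within {0..T} = at s"
        using that h by (intro at_within_interior) (auto simp: interior_atLeastAtMost_real)
      then show ?thesis
        using der[of s] that h by (auto simp: has_vector_derivative_def)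
    qed
    from mvt_general[OF h(1) cont this]
    obtain s where s: "0 < s" "s < h" "norm (E h) \<le> norm ((h - 0) *\<^sub>R E' s)"
      using assms(2) by auto
    note s(3)
    also have "norm ((h - 0) *\<^sub>R E' s) \<le> h * (c * s ^ m)"
      using bound[of s] s h by (auto intro!: mult_left_mono)
    also have "\<dots> \<le> h * (c * h ^ m)"
      using s h c by (intro mult_left_mono power_mono) auto
    finally show ?thesis by (simp add: ac_simps)
  qed
  moreover have "eventually (\<lambda>h. 0 < h \<and> h < min e T) (at_right 0)"
    using e assms(1) unfolding eventually_at_right_field by (intro exI[of _ "min e T"]) auto
  ultimately have "eventually (\<lambda>h. norm (norm (E h)) \<le> c * norm (h ^ Suc m)) (at_right 0)"
    by (auto elim!: eventually_mono simp: abs_mult)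
  then show ?thesis
    unfolding vanishes_def by (rule bigoI)
qed

section \<open>Second-order Taylor expansion\<close>

lemma differentiable_imp_lipschitz_at:
  assumes "g differentiable (at x)"
  shows "(\<lambda>d. norm (g (x + d) - g x)) \<in> O[nhds 0](\<lambda>d. norm d)"
proof -
  obtain D where D: "(g has_derivative D) (at x)"
    using assms by (auto simp: differentiable_def)
  then interpret D: bounded_linear D by (rule has_derivative_bounded_linear)
  obtain K where K: "\<And>d. norm (D d) \<le> norm d * K"
    using D.bounded by blast
  obtain e where e: "e > 0"
    "\<And>y. norm (y - x) < e \<Longrightarrow> norm (g y - g x - D (y - x)) \<le> 1 * norm (y - x)"
    using D[unfolded has_derivative_at_alt] zero_less_one by metis
  have "norm (g (x + d) - g x) \<le> (1 + K) * norm d" if "norm d < e" for d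
  proof -
    have "norm (g (x + d) - g x) \<le> norm (g (x + d) - g x - D d) + norm (D d)"
      by (metis norm_triangle_sub add.commute)
    with e(2)[of "x + d"] K[of d] that show ?thesis by (simp add: algebra_simps)
  qed
  then show ?thesis
    using e(1) by (intro bigoI[of _ "1 + K"])
      (auto simp: eventually_nhds_metric dist_norm)
qed

text \<open>The induction step of Taylor's formula, for \<open>P\<close> zero (first order) and for \<open>P\<close> the derivatives of
the partial derivatives (second order). Both cases reduce to the mean value inequality along the
segment from \<open>x\<close> to \<open>x + d\<close>, where the \<open>P i\<close> are evaluated at multiples of \<open>d\<close> only. Expanding the
direction in the basis leaves finitely many remainders, which makes the bound uniform in \<open>d\<close>.\<close>
lemma segment_taylor:
  fixes f :: "'a::euclidean_space \<Rightarrow> 'b::real_inner"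
  assumes diff: "\<And>x. f differentiable (at x)"
    and lin: "\<And>i. i \<in> Basis \<Longrightarrow> linear (P i)"
    and err: "\<And>i. i \<in> Basis \<Longrightarrow>
      (\<lambda>d. norm (frechet_derivative f (at (x + d)) i - frechet_derivative f (at x) i - P i d))
        \<in> O[nhds 0](\<lambda>d. norm d ^ m)"
  shows "(\<lambda>d. norm (f (x + d) - f x - frechet_derivative f (at x) d
                - (1/2) *\<^sub>R (\<Sum>i\<in>Basis. (d \<bullet> i) *\<^sub>R P i d))) \<in> O[nhds 0](\<lambda>d. norm d ^ Suc m)"
proof -
  define D where "D = (\<lambda>y. frechet_derivative f (at y))"
  define R where "R = (\<lambda>i d. D (x + d) i - D x i - P i d)"
  have D: "(f has_derivative D y) (at y)" for y
    using diff frechet_derivative_works unfolding D_def by blast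
  have D_basis: "D y d = (\<Sum>i\<in>Basis. (d \<bullet> i) *\<^sub>R D y i)" for y d
  proof -
    have "linear (D y)" using D has_derivative_linear by blast
    then have "D y (\<Sum>i\<in>Basis. (d \<bullet> i) *\<^sub>R i) = (\<Sum>i\<in>Basis. (d \<bullet> i) *\<^sub>R D y i)"
      by (simp add: linear_sum linear_cmul)
    then show ?thesis by (simp add: euclidean_representation)
  qed
  have "(\<lambda>d. \<Sum>i\<in>Basis. norm (R i d)) \<in> O[nhds 0](\<lambda>d. norm d ^ m)"
    using err unfolding R_def D_def by (intro big_sum_in_bigo) auto
  then obtain c where c: "c > 0"
    and ev: "eventually (\<lambda>d. norm (\<Sum>i\<in>Basis. norm (R i d)) \<le> c * norm (norm d ^ m)) (nhds 0)"
    by (elim landau_o.bigE)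
  then obtain e where e: "e > 0"
    and bound: "\<And>d. norm d < e \<Longrightarrow> (\<Sum>i\<in>Basis. norm (R i d)) \<le> c * norm d ^ m"
    by (auto simp: eventually_nhds_metric sum_nonneg abs_of_nonneg)
  have "norm (f (x + d) - f x - D x d - (1/2) *\<^sub>R (\<Sum>i\<in>Basis. (d \<bullet> i) *\<^sub>R P i d))
      \<le> c * norm d ^ Suc m" if d: "norm d < e" for d
  proof -
    define S where "S = (\<Sum>i\<in>Basis. (d \<bullet> i) *\<^sub>R P i d)"
    \<comment> \<open>The remainder on the segment; \<open>\<rho> 1 - \<rho> 0\<close> is the vector to be estimated.\<close>
    define \<rho> where "\<rho> = (\<lambda>t. f (x + t *\<^sub>R d) - t *\<^sub>R D x d - (t\<^sup>2 / 2) *\<^sub>R S)"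
    define \<rho>' where "\<rho>' = (\<lambda>t. D (x + t *\<^sub>R d) d - D x d - t *\<^sub>R S)"
    have der: "(\<rho> has_derivative (\<lambda>u. u *\<^sub>R \<rho>' t)) (at t)" for t
    proof -
      have "((\<lambda>t. f (x + t *\<^sub>R d)) has_derivative (\<lambda>u. D (x + t *\<^sub>R d) (u *\<^sub>R d))) (at t)"
        by (rule has_derivative_compose[OF _ D]) (auto intro!: derivative_eq_intros)
      moreover have "D (x + t *\<^sub>R d) (u *\<^sub>R d) = u *\<^sub>R D (x + t *\<^sub>R d) d" for u
        using D has_derivative_linear linear_cmul by blast
      ultimately have "((\<lambda>t. f (x + t *\<^sub>R d)) has_derivative (\<lambda>u. u *\<^sub>R D (x + t *\<^sub>R d) d)) (at t)"
        by simp
      then show ?thesis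
        unfolding \<rho>_def \<rho>'_def
        by (auto intro!: derivative_eq_intros simp: algebra_simps)
    qed
    have "continuous_on {0..1} \<rho>"
      using der by (meson has_derivative_continuous_on has_derivative_at_withinI)
    from mvt_general[OF zero_less_one this der]
    obtain t where t: "0 < t" "t < 1" "norm (\<rho> 1 - \<rho> 0) \<le> norm (\<rho>' t)"
      by auto
    have "\<rho>' t = (\<Sum>i\<in>Basis. (d \<bullet> i) *\<^sub>R R i (t *\<^sub>R d))"
      unfolding \<rho>'_def R_def S_def
      by (subst (1 2) D_basis)
        (simp add: sum_subtractf scaleR_diff_right scaleR_sum_right linear_cmul[OF lin] ac_simps)
    also have "norm \<dots> \<le> (\<Sum>i\<in>Basis. norm d * norm (R i (t *\<^sub>R d)))"
      by (intro sum_norm_le) (auto intro!: mult_right_mono simp: Basis_le_norm)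
    also have "\<dots> \<le> norm d * (c * norm (t *\<^sub>R d) ^ m)"
      unfolding sum_distrib_left[symmetric]
    proof (intro mult_left_mono bound norm_ge_zero)
      have "norm (t *\<^sub>R d) \<le> norm d"
        using t by (simp add: mult_left_le_one_le)
      then show "norm (t *\<^sub>R d) < e" using d by simp
    qed
    also have "\<dots> \<le> norm d * (c * norm d ^ m)"
      using t c by (intro mult_left_mono power_mono) (auto simp: mult_left_le_one_le)
    finally have "norm (\<rho> 1 - \<rho> 0) \<le> c * norm d ^ Suc m"
      using t(3) by (simp add: ac_simps)
    then show ?thesis
      by (simp add: \<rho>_def S_def algebra_simps)
  qed
  then show ?thesis
    using e c unfolding D_def by (intro bigoI[of _ c])
      (auto simp: eventually_nhds_metric dist_norm abs_mult)
qed

lemma taylor_second_order: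
  fixes f :: "'a::euclidean_space \<Rightarrow> 'b::euclidean_space"
  assumes "k_times_differentiable 3 f"
  obtains J B where "bounded_linear J" "bounded_bilinear B"
    "(\<lambda>d. norm (f (x + d) - f x - J d - (1/2) *\<^sub>R B d d)) \<in> O[nhds 0](\<lambda>d. norm d ^ 3)"
proof -
  define D where "D = (\<lambda>v y. frechet_derivative f (at y) v)"
  define DD where "DD = (\<lambda>v w y. frechet_derivative (D v) (at y) w)"
  define B where "B = (\<lambda>u v. \<Sum>i\<in>Basis. (v \<bullet> i) *\<^sub>R DD i u x)"
  have f: "f differentiable (at y)" and D: "D v differentiable (at y)"
    and DD: "DD v w differentiable (at y)" for v w y
    using assms by (auto simp: numeral_3_eq_3 D_def DD_def)
  have "(\<lambda>d. norm (D i (x + d) - D i x - DD i d x)) \<in> O[nhds 0](\<lambda>d. norm d ^ 2)" for i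
    using segment_taylor[of "D i" "\<lambda>_ _. 0" x 1]
      D differentiable_imp_lipschitz_at[OF DD, of i _ x]
    by (simp add: DD_def linear_zero numeral_2_eq_2)
  then have "(\<lambda>d. norm (f (x + d) - f x - frechet_derivative f (at x) d
                - (1/2) *\<^sub>R (\<Sum>i\<in>Basis. (d \<bullet> i) *\<^sub>R DD i d x))) \<in> O[nhds 0](\<lambda>d. norm d ^ Suc 2)"
    using f D by (intro segment_taylor)
      (auto simp: D_def DD_def intro!: linear_frechet_derivative)
  then have "(\<lambda>d. norm (f (x + d) - f x - frechet_derivative f (at x) d - (1/2) *\<^sub>R B d d))
               \<in> O[nhds 0](\<lambda>d. norm d ^ 3)"
    by (simp add: B_def)
  moreover have "bounded_linear (frechet_derivative f (at x))"
    using f by (simp add: linear_frechet_derivative linear_conv_bounded_linear[symmetric])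
  moreover have "bilinear B"
    unfolding bilinear_def
  proof (intro conjI allI)
    fix u
    show "linear (B u)"
      unfolding B_def by (rule linearI)
        (auto simp: inner_add_left scaleR_add_left sum.distrib scaleR_sum_right)
  next
    fix v
    have "linear (\<lambda>u. DD i u x)" for i
      unfolding DD_def using D by (rule linear_frechet_derivative)
    then show "linear (\<lambda>u. B u v)"
      unfolding B_def by (intro linear_compose_sum ballI linear_compose_scale_right)
  qed
  ultimately show ?thesis
    using that bilinear_conv_bounded_bilinear by blast
qed

section \<open>Truncation of the matrix functions \<open>\<phi>\<^sub>k\<close> and \<open>\<psi>\<^sub>j\<close>\<close>

lemma bounded_bilinear_matrix_mult:
  "bounded_bilinear ((**) :: real^'n^'n \<Rightarrow> real^'n^'n \<Rightarrow> real^'n^'n)"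
  unfolding bilinear_conv_bounded_bilinear[symmetric] bilinear_def
proof (intro conjI allI linearI)
  fix X Y Z :: "real^'n^'n" and c :: real
  show "(X + Y) ** Z = X ** Z + Y ** Z"
    by (simp add: matrix_matrix_mult_def vec_eq_iff sum.distrib distrib_right)
  show "X ** (Y + Z) = X ** Y + X ** Z"
    by (rule matrix_add_ldistrib)
  show "X ** (c *\<^sub>R Y) = c *\<^sub>R (X ** Y)"
    by (simp only: matrix_scalar_ac scalar_matrix_assoc)
  show "(c *\<^sub>R X) ** Y = c *\<^sub>R (X ** Y)"
    by (simp only: scalar_matrix_assoc)
qed

lemma bounded_bilinear_matrix_vector_mult:
  "bounded_bilinear ((*v) :: real^'n^'n \<Rightarrow> real^'n \<Rightarrow> real^'n)"
  unfolding bilinear_conv_bounded_bilinear[symmetric] bilinear_def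
  by (intro conjI allI linearI)
    (simp_all only: matrix_vector_right_distrib matrix_vector_mult_add_rdistrib
      matrix_vector_mult_scaleR scaleR_matrix_vector_assoc)

lemma mat_power_scaleR:
  fixes Z :: "real^'n^'n"
  shows "mat_power (c *\<^sub>R Z) i = c ^ i *\<^sub>R mat_power Z i"
proof (induction i)
  case (Suc i)
  then show ?case
    using bounded_bilinear.scaleR_left[OF bounded_bilinear_matrix_mult, of c Z "mat_power Z i"]
      bounded_bilinear.scaleR_right[OF bounded_bilinear_matrix_mult, of "c *\<^sub>R Z" "c ^ i" "mat_power Z i"]
    by simp
qed simp

lemma norm_mat_power_le:
  fixes Z :: "real^'n^'n"
  obtains M c where "\<And>i. norm (mat_power Z i) \<le> M * c ^ i" "c \<ge> 0"
proof -
  obtain K where K: "K > 0" "\<And>X Y. norm ((X :: real^'n^'n) ** (Y :: real^'n^'n)) \<le> norm X * norm Y * K"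
    using bounded_bilinear.pos_bounded[OF bounded_bilinear_matrix_mult] by blast
  have "norm (mat_power Z i) \<le> norm (mat 1 :: real^'n^'n) * (norm Z * K) ^ i" for i
  proof (induction i)
    case (Suc i)
    have "norm (mat_power Z (Suc i)) \<le> norm Z * norm (mat_power Z i) * K"
      using K(2) by simp
    also have "\<dots> \<le> norm Z * (norm (mat 1 :: real^'n^'n) * (norm Z * K) ^ i) * K"
      using Suc K(1) by (intro mult_right_mono mult_left_mono) auto
    finally show ?case by (simp add: ac_simps)
  qed simp
  from that[OF this] K(1) show ?thesis by simp
qed

text \<open>The terms are dominated by those of the exponential series, because \<open>(i + k)! \<ge> i!\<close> and the powers
of a matrix grow at most geometrically.\<close>
lemma summable_phi_coeffs:
  fixes Z :: "real^'n^'n"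
  shows "summable (\<lambda>i. norm ((1 / fact (i + k)) *\<^sub>R mat_power Z i))"
proof -
  obtain M c where M: "\<And>i. norm (mat_power Z i) \<le> M * c ^ i" and c: "c \<ge> 0"
    using norm_mat_power_le[of Z] by blast
  have "summable (\<lambda>i. M * (inverse (fact i) * c ^ i))"
    by (intro summable_mult summable_exp)
  then show ?thesis
  proof (rule summable_comparison_test'[where N = 0])
    fix i :: nat
    have "norm ((1 / fact (i + k)) *\<^sub>R mat_power Z i) = inverse (fact (i + k)) * norm (mat_power Z i)"
      by (simp add: divide_inverse)
    also have "\<dots> \<le> inverse (fact i) * (M * c ^ i)"
      using M[of i] by (intro mult_mono le_imp_inverse_le fact_mono) auto
    finally show "norm (norm ((1 / fact (i + k)) *\<^sub>R mat_power Z i)) \<le> M * (inverse (fact i) * c ^ i)"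
      by (simp add: ac_simps)
  qed
qed

text \<open>After \<open>h\<^sup>m\<close> is taken out of the tail of the series, what remains is bounded, uniformly for
\<open>0 < h < 1\<close>, by the tail of the absolutely convergent series at \<open>h = 1\<close>.\<close>
lemma phi_expansion:
  "vanishes m (\<lambda>h. phi k (h *\<^sub>R Z) - (\<Sum>i<m. (h ^ i / fact (i + k)) *\<^sub>R mat_power Z i))"
proof -
  define c where "c = (\<lambda>i. (1 / fact (i + k)) *\<^sub>R mat_power Z i)"
  have c: "summable (\<lambda>i. norm (c i))"
    unfolding c_def by (rule summable_phi_coeffs)
  have phi: "phi k (h *\<^sub>R Z) = (\<Sum>i. h ^ i *\<^sub>R c i)" for h
    by (simp add: phi_def c_def mat_power_scaleR ac_simps)
  have "norm (phi k (h *\<^sub>R Z) - (\<Sum>i<m. h ^ i *\<^sub>R c i)) \<le> (\<Sum>i. norm (c (i + m))) * h ^ m"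
    if h: "0 < h" "h < 1" for h :: real
  proof -
    have le: "norm (h ^ i *\<^sub>R c i) \<le> norm (c i)" for i
      using h by (simp add: mult_left_le_one_le power_le_one)
    have sum: "summable (\<lambda>i. norm (h ^ i *\<^sub>R c i))"
      by (rule summable_comparison_test'[OF c, of 0]) (use le in simp)
    have "phi k (h *\<^sub>R Z) - (\<Sum>i<m. h ^ i *\<^sub>R c i) = (\<Sum>i. h ^ (i + m) *\<^sub>R c (i + m))"
      unfolding phi using suminf_minus_initial_segment[OF summable_norm_cancel[OF sum]] by metis
    also have "norm \<dots> \<le> (\<Sum>i. h ^ m * norm (c (i + m)))"
    proof (rule order_trans[OF summable_norm suminf_le])
      show "summable (\<lambda>i. norm (h ^ (i + m) *\<^sub>R c (i + m)))"
        using summable_ignore_initial_segment[OF sum, of m] .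
      then show "summable (\<lambda>i. norm (h ^ (i + m) *\<^sub>R c (i + m)))" .
      show "summable (\<lambda>i. h ^ m * norm (c (i + m)))"
        by (intro summable_mult summable_ignore_initial_segment[OF c])
      show "norm (h ^ (i + m) *\<^sub>R c (i + m)) \<le> h ^ m * norm (c (i + m))" for i
        using h by (auto simp: power_add intro!: mult_right_mono mult_left_le_one_le power_le_one)
    qed
    also have "\<dots> = (\<Sum>i. norm (c (i + m))) * h ^ m"
      using summable_ignore_initial_segment[OF c, of m] by (simp add: suminf_mult mult.commute)
    finally show ?thesis .
  qed
  moreover have "eventually (\<lambda>h::real. 0 < h \<and> h < 1) (at_right 0)"
    unfolding eventually_at_right_field by (intro exI[of _ 1]) auto
  ultimately have "eventually (\<lambda>h. norm (norm (phi k (h *\<^sub>R Z) - (\<Sum>i<m. h ^ i *\<^sub>R c i)))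
      \<le> (\<Sum>i. norm (c (i + m))) * norm (h ^ m)) (at_right 0)"
    by (auto elim!: eventually_mono)
  then show ?thesis
    unfolding vanishes_def by (intro bigoI) (simp add: c_def)
qed

text \<open>The Taylor coefficients of the scalar function \<open>\<psi>\<^sub>j\<close> at \<open>0\<close>.\<close>
definition psi_coeff :: "(nat \<Rightarrow> nat \<Rightarrow> real) \<Rightarrow> nat \<Rightarrow> nat \<Rightarrow> real" where
  "psi_coeff p j i = (\<Sum>k=1..j. p j k / fact (i + k))"

lemma psi_expansion:
  "vanishes m (\<lambda>h. psi p j (h *\<^sub>R Z) - (\<Sum>i<m. (h ^ i * psi_coeff p j i) *\<^sub>R mat_power Z i))"
proof -
  have "vanishes m (\<lambda>h. \<Sum>k=1..j. p j k *\<^sub>R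
      (phi k (h *\<^sub>R Z) - (\<Sum>i<m. (h ^ i / fact (i + k)) *\<^sub>R mat_power Z i)))"
    by (intro vanishes_sum vanishes_scaleR phi_expansion)
  also have "(\<lambda>h. \<Sum>k=1..j. p j k *\<^sub>R
      (phi k (h *\<^sub>R Z) - (\<Sum>i<m. (h ^ i / fact (i + k)) *\<^sub>R mat_power Z i)))
    = (\<lambda>h. psi p j (h *\<^sub>R Z) - (\<Sum>i<m. (h ^ i * psi_coeff p j i) *\<^sub>R mat_power Z i))"
    unfolding psi_def psi_coeff_def sum_distrib_left scaleR_sum_left
    by (subst sum.swap)
      (simp add: scaleR_diff_right sum_subtractf scaleR_sum_right ac_simps)
  finally show ?thesis .
qed

text \<open>A factor \<open>O(h\<^sup>l)\<close> in the argument improves the error by \<open>l\<close> powers. It is used with \<open>l = 1\<close> for the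
terms of the scheme and with \<open>m = 0\<close>, where the sum is empty, for errors that \<open>\<psi>\<^sub>j\<close> is applied to.\<close>
lemma psi_vector_expansion:
  assumes "vanishes l w"
  shows "vanishes (m + l) (\<lambda>h. psi p j (h *\<^sub>R Z) *v w h
           - (\<Sum>i<m. (h ^ i * psi_coeff p j i) *\<^sub>R (mat_power Z i *v w h)))"
proof -
  have "vanishes (m + l) (\<lambda>h. (psi p j (h *\<^sub>R Z)
           - (\<Sum>i<m. (h ^ i * psi_coeff p j i) *\<^sub>R mat_power Z i)) *v w h)"
    by (rule vanishes_bounded_bilinear[OF bounded_bilinear_matrix_vector_mult psi_expansion assms])
  then show ?thesis
    by (simp add: bounded_bilinear.diff_left[OF bounded_bilinear_matrix_vector_mult]
        bounded_bilinear.sum_left[OF bounded_bilinear_matrix_vector_mult]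
        bounded_bilinear.scaleR_left[OF bounded_bilinear_matrix_vector_mult])
qed

section \<open>Expansion of the vector field and of the exact solution\<close>

locale quadratic_model = J: bounded_linear J + B: bounded_bilinear B
  for J :: "'a::euclidean_space \<Rightarrow> 'a" and B :: "'a \<Rightarrow> 'a \<Rightarrow> 'a" +
  fixes f :: "'a \<Rightarrow> 'a" and x :: 'a
  assumes taylor: "(\<lambda>d. norm (f (x + d) - f x - J d - (1/2) *\<^sub>R B d d)) \<in> O[nhds 0](\<lambda>d. norm d ^ 3)"
begin

lemma taylor_along_curve:
  assumes d: "vanishes 1 d"
  shows "vanishes 3 (\<lambda>h. f (x + d h) - f x - J (d h) - (1/2) *\<^sub>R B (d h) (d h))"
proof -
  have "filterlim d (nhds 0) (at_right 0)"
    using vanishes_tendsto[of 0 d] d by simp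
  then have "(\<lambda>h. norm (f (x + d h) - f x - J (d h) - (1/2) *\<^sub>R B (d h) (d h)))
      \<in> O[at_right 0](\<lambda>h. norm (d h) ^ 3)"
    by (rule landau_o.big.compose[OF taylor])
  moreover have "(\<lambda>h. norm (d h) ^ 3) \<in> O[at_right 0](\<lambda>h. (h ^ 1) ^ 3)"
    using d unfolding vanishes_def by (rule landau_o.big_power)
  ultimately show ?thesis
    unfolding vanishes_def by (simp add: landau_o.big_trans)
qed

text \<open>Inserting \<open>d = h e1 + h\<^sup>2 e2 + O(h\<^sup>3)\<close> into the quadratic model. In the bilinear term one argument is
replaced at a time; each replacement costs \<open>O(h\<^sup>2)\<close> and is multiplied by an argument that is \<open>O(h)\<close>.\<close>
lemma quadratic_expansion:
  assumes d: "vanishes 3 (\<lambda>h. d h - (h *\<^sub>R e1 + h\<^sup>2 *\<^sub>R e2))"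
  shows "vanishes 3 (\<lambda>h. J (d h) + (1/2) *\<^sub>R B (d h) (d h)
           - (h *\<^sub>R J e1 + h\<^sup>2 *\<^sub>R (J e2 + (1/2) *\<^sub>R B e1 e1)))"
proof -
  have lin: "vanishes 2 (\<lambda>h. d h - h *\<^sub>R e1)"
    using vanishes_add[OF vanishes_mono[OF d, of 2] vanishes_monomial[of 2 2 e2]]
    by (simp add: algebra_simps)
  have e1: "vanishes 1 (\<lambda>h. h *\<^sub>R e1)"
    using vanishes_monomial[of 1 1 e1] by simp
  have d1: "vanishes 1 d"
    using vanishes_add[OF vanishes_mono[OF lin, of 1] e1] by simp
  have "vanishes 3 (\<lambda>h. J (d h - (h *\<^sub>R e1 + h\<^sup>2 *\<^sub>R e2)) + (1/2) *\<^sub>R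
      (B (d h) (d h - h *\<^sub>R e1) + B (d h - h *\<^sub>R e1) (h *\<^sub>R e1)))"
    using vanishes_bounded_linear[OF J.bounded_linear_axioms d] vanishes_bounded_bilinear[OF B.bounded_bilinear_axioms d1 lin]
      vanishes_bounded_bilinear[OF B.bounded_bilinear_axioms lin e1]
    by (intro vanishes_add vanishes_scaleR) (auto simp: numeral_3_eq_3)
  also have "(\<lambda>h. J (d h - (h *\<^sub>R e1 + h\<^sup>2 *\<^sub>R e2)) + (1/2) *\<^sub>R
      (B (d h) (d h - h *\<^sub>R e1) + B (d h - h *\<^sub>R e1) (h *\<^sub>R e1)))
    = (\<lambda>h. J (d h) + (1/2) *\<^sub>R B (d h) (d h)
           - (h *\<^sub>R J e1 + h\<^sup>2 *\<^sub>R (J e2 + (1/2) *\<^sub>R B e1 e1)))"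
    by (simp add: J.diff J.add J.scaleR B.diff_left B.diff_right B.scaleR_left B.scaleR_right
        algebra_simps power2_eq_square)
  finally show ?thesis .
qed

lemma function_expansion:
  assumes d: "vanishes 3 (\<lambda>h. d h - (h *\<^sub>R e1 + h\<^sup>2 *\<^sub>R e2))"
  shows "vanishes 3 (\<lambda>h. f (x + d h)
           - (f x + h *\<^sub>R J e1 + h\<^sup>2 *\<^sub>R (J e2 + (1/2) *\<^sub>R B e1 e1)))"
proof -
  have "vanishes 1 (\<lambda>h. (d h - (h *\<^sub>R e1 + h\<^sup>2 *\<^sub>R e2)) + (h ^ 1 *\<^sub>R e1 + h\<^sup>2 *\<^sub>R e2))"
    by (intro vanishes_add vanishes_monomial vanishes_mono[OF d]) auto
  then have "vanishes 1 d" by simp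
  from vanishes_add[OF taylor_along_curve[OF this] quadratic_expansion[OF d]]
  show ?thesis by (simp add: algebra_simps)
qed

text \<open>Bootstrapping: \<open>e(h) = y(t\<^sub>n + h) - y\<^sub>n\<close> satisfies \<open>e' = f(y\<^sub>n + e)\<close>, so an expansion of \<open>e\<close> up to
\<open>O(h\<^sup>m)\<close> yields one of \<open>f(y\<^sub>n + e)\<close> up to \<open>O(h\<^sup>m)\<close>, and integration turns it into an expansion of \<open>e\<close>
up to \<open>O(h\<^sup>m\<^sup>+\<^sup>1)\<close>. Continuity of \<open>e\<close> starts the process at \<open>m = 0\<close>.\<close>
lemma exact_solution_expansion:
  assumes cont: "continuous_on UNIV f"
    and T: "T > 0" and init: "y tn = x"
    and ode: "\<And>t. t \<in> {tn..tn + T} \<Longrightarrow>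
                (y has_vector_derivative f (y t)) (at t within {tn..tn + T})"
  shows "vanishes 4 (\<lambda>h. y (tn + h) - (x + h *\<^sub>R f x + h\<^sup>2 *\<^sub>R ((1/2) *\<^sub>R J (f x))
           + h ^ 3 *\<^sub>R ((1/6) *\<^sub>R (J (J (f x)) + B (f x) (f x)))))"
proof -
  define e where "e = (\<lambda>h. y (tn + h) - x)"
  have y: "y (tn + h) = x + e h" for h
    by (simp add: e_def)
  have der: "(e has_vector_derivative f (x + e s)) (at s within {0..T})" if "s \<in> {0..T}" for s
  proof -
    have "(y has_vector_derivative f (y (tn + s))) (at (tn + s) within {tn..tn + T})"
      using ode that by simp
    moreover have "((+) tn has_vector_derivative 1) (at s within {0..T})"
      by (auto intro!: derivative_eq_intros)
    ultimately have "((\<lambda>h. y (tn + h)) has_vector_derivative f (y (tn + s))) (at s within {0..T})"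
      using vector_diff_chain_within[of "(+) tn" 1 s "{0..T}" y "f (y (tn + s))"]
      by (simp add: o_def add.commute)
    then show ?thesis
      unfolding y[symmetric] unfolding e_def by (auto intro!: derivative_eq_intros)
  qed
  have gain: "vanishes (Suc m) (\<lambda>h. e h - (h *\<^sub>R f x + (h\<^sup>2 / 2) *\<^sub>R a + (h ^ 3 / 3) *\<^sub>R b))"
    if "vanishes m (\<lambda>s. f (x + e s) - (f x + s *\<^sub>R a + s\<^sup>2 *\<^sub>R b))" for m a b
    using T _ _ that
  proof (rule vanishes_mean_value)
    fix s assume "s \<in> {0..T}"
    from der[OF this]
    show "((\<lambda>h. e h - (h *\<^sub>R f x + (h\<^sup>2 / 2) *\<^sub>R a + (h ^ 3 / 3) *\<^sub>R b)) has_vector_derivative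
        f (x + e s) - (f x + s *\<^sub>R a + s\<^sup>2 *\<^sub>R b)) (at s within {0..T})"
      by (auto intro!: derivative_eq_intros simp: power2_eq_square)
  qed (simp add: e_def init)
  \<comment> \<open>The first round: \<open>f\<close> is bounded along the solution, which gives \<open>e = O(h)\<close>.\<close>
  have "vanishes 1 e"
  proof -
    have "continuous_on {0..T} e"
      using der by (rule continuous_on_vector_derivative)
    then have "(e \<longlongrightarrow> e 0) (at 0 within {0..T})"
      using T by (auto simp: continuous_on_def)
    then have "(e \<longlongrightarrow> 0) (at_right 0)"
      using T by (simp add: e_def init at_within_Icc_at_right)
    then have "((\<lambda>s. f (x + e s)) \<longlongrightarrow> f (x + 0)) (at_right 0)"
      using cont by (intro continuous_on_tendsto_compose[OF cont] tendsto_intros) auto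
    then have "((\<lambda>s. norm (f (x + e s))) \<longlongrightarrow> norm (f x)) (at_right 0)"
      by (intro tendsto_norm) simp
    then have "vanishes 0 (\<lambda>s. f (x + e s))"
      unfolding vanishes_def by (intro bigoI_tendsto[where c = "norm (f x)"]) auto
    then have "vanishes 0 (\<lambda>s. f (x + e s) - (f x + s *\<^sub>R 0 + s\<^sup>2 *\<^sub>R 0))"
      by (auto intro!: vanishes_diff)
    from vanishes_add[OF gain[OF this] vanishes_monomial[of "Suc 0" 1 "f x"]] show ?thesis
      by simp
  qed
  note rest = taylor_along_curve[OF this]
  have "vanishes 1 (\<lambda>s. (f (x + e s) - f x - J (e s) - (1/2) *\<^sub>R B (e s) (e s))
      + J (e s) + (1/2) *\<^sub>R B (e s) (e s))"
    using vanishes_bounded_bilinear[OF B.bounded_bilinear_axioms \<open>vanishes 1 e\<close> \<open>vanishes 1 e\<close>]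
    by (intro vanishes_add vanishes_scaleR vanishes_bounded_linear[OF J.bounded_linear_axioms] \<open>vanishes 1 e\<close>
        vanishes_mono[OF rest]) (auto elim: vanishes_mono)
  then have "vanishes 1 (\<lambda>s. f (x + e s) - (f x + s *\<^sub>R 0 + s\<^sup>2 *\<^sub>R 0))"
    by (simp add: algebra_simps)
  from gain[OF this] have e2: "vanishes 2 (\<lambda>s. e s - s *\<^sub>R f x)"
    by (simp add: numeral_2_eq_2)
  have "vanishes 2 (\<lambda>s. (f (x + e s) - f x - J (e s) - (1/2) *\<^sub>R B (e s) (e s))
      + J (e s - s *\<^sub>R f x) + (1/2) *\<^sub>R B (e s) (e s))"
    using vanishes_bounded_bilinear[OF B.bounded_bilinear_axioms \<open>vanishes 1 e\<close> \<open>vanishes 1 e\<close>]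
    by (intro vanishes_add vanishes_scaleR vanishes_bounded_linear[OF J.bounded_linear_axioms] e2
        vanishes_mono[OF rest]) (auto simp: numeral_2_eq_2)
  then have "vanishes 2 (\<lambda>s. f (x + e s) - (f x + s *\<^sub>R J (f x) + s\<^sup>2 *\<^sub>R 0))"
    by (simp add: algebra_simps J.diff J.scaleR)
  from gain[OF this] have "vanishes 3 (\<lambda>s. e s - (s *\<^sub>R f x + s\<^sup>2 *\<^sub>R ((1/2) *\<^sub>R J (f x))))"
    by (simp add: numeral_3_eq_3 numeral_2_eq_2)
  from gain[OF function_expansion[OF this]] show ?thesis
    unfolding y by (simp add: J.scaleR algebra_simps)
qed

end

section \<open>Expansion of the numerical step\<close>

text \<open>The common form of all terms of the scheme: \<open>w\<close> is \<open>f(y\<^sub>n)\<close> or a forward difference of the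
remainder, and the factor \<open>h\<close> in front of \<open>w\<close> is why an error \<open>O(h\<^sup>3)\<close> in \<open>w\<close> is admissible.\<close>
lemma psi_third_order_expansion:
  fixes A :: "real^'n^'n"
  assumes w: "vanishes 3 (\<lambda>h. w h - (v0 + h *\<^sub>R v1 + h\<^sup>2 *\<^sub>R v2))"
  shows "vanishes 4 (\<lambda>h. psi p j ((c * h) *\<^sub>R A) *v (h *\<^sub>R w h)
           - (h *\<^sub>R (psi_coeff p j 0 *\<^sub>R v0)
            + h\<^sup>2 *\<^sub>R (psi_coeff p j 0 *\<^sub>R v1 + (c * psi_coeff p j 1) *\<^sub>R (A *v v0))
            + h ^ 3 *\<^sub>R (psi_coeff p j 0 *\<^sub>R v2 + (c * psi_coeff p j 1) *\<^sub>R (A *v v1)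
                + (c\<^sup>2 * psi_coeff p j 2) *\<^sub>R (A *v (A *v v0)))))"
proof -
  define \<mu> where "\<mu> = psi_coeff p j"
  define P where "P = (\<lambda>h. v0 + h *\<^sub>R v1 + h\<^sup>2 *\<^sub>R v2)"
  define M where "M = mat_power (c *\<^sub>R A)"
  have M: "M 0 *v v = v" "M (Suc 0) *v v = c *\<^sub>R (A *v v)" "M 2 *v v = c\<^sup>2 *\<^sub>R (A *v (A *v v))" for v
  proof -
    have "M i *v v = c ^ i *\<^sub>R (mat_power A i *v v)" for i
      by (simp only: M_def mat_power_scaleR scaleR_matrix_vector_assoc)
    then show "M 0 *v v = v" "M (Suc 0) *v v = c *\<^sub>R (A *v v)" "M 2 *v v = c\<^sup>2 *\<^sub>R (A *v (A *v v))"
      by (simp_all add: numeral_2_eq_2 matrix_vector_mul_assoc)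
  qed
  have "vanishes 0 (\<lambda>h. (w h - P h) + (v0 + h ^ 1 *\<^sub>R v1 + h\<^sup>2 *\<^sub>R v2))"
    unfolding P_def by (intro vanishes_add vanishes_monomial vanishes_mono[OF w]) auto
  then have "vanishes 0 w" by (simp add: P_def)
  then have "vanishes (3 + 1) (\<lambda>h. psi p j (h *\<^sub>R (c *\<^sub>R A)) *v (h *\<^sub>R w h)
           - (\<Sum>i<3. (h ^ i * \<mu> i) *\<^sub>R (M i *v (h *\<^sub>R w h))))"
    (is "vanishes _ ?psi_error")
    unfolding M_def \<mu>_def by (intro psi_vector_expansion) (use vanishes_step_scaleR in force)
  then have psi_error: "vanishes 4 ?psi_error"
    by (rule vanishes_mono) simp
  have argument_error: "vanishes 4 (\<lambda>h. \<Sum>i<3. h ^ i *\<^sub>R (\<mu> i *\<^sub>R (M i *v (h *\<^sub>R (w h - P h)))))"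
  proof (rule vanishes_sum)
    fix i :: nat
    have "vanishes (Suc 3) (\<lambda>h. \<mu> i *\<^sub>R (M i *v (h *\<^sub>R (w h - P h))))"
      using w unfolding P_def by (intro vanishes_scaleR vanishes_step_scaleR
          vanishes_bounded_linear[OF matrix_vector_mul_bounded_linear])
    from vanishes_mono[OF vanishes_power_scaleR[OF this, of i], of 4]
    show "vanishes 4 (\<lambda>h. h ^ i *\<^sub>R (\<mu> i *\<^sub>R (M i *v (h *\<^sub>R (w h - P h)))))"
      by simp
  qed
  \<comment> \<open>The products of the truncated series with the truncated \<open>w\<close> that are beyond \<open>h\<^sup>3\<close>.\<close>
  have high_powers: "vanishes 4 (\<lambda>h. h ^ 4 *\<^sub>R ((c * \<mu> 1) *\<^sub>R (A *v v2) + (c\<^sup>2 * \<mu> 2) *\<^sub>R (A *v (A *v v1)))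
      + h ^ 5 *\<^sub>R ((c\<^sup>2 * \<mu> 2) *\<^sub>R (A *v (A *v v2))))"
    by (intro vanishes_add vanishes_monomial) auto
  have "vanishes 4 (\<lambda>h. (psi p j (h *\<^sub>R (c *\<^sub>R A)) *v (h *\<^sub>R w h)
           - (\<Sum>i<3. (h ^ i * \<mu> i) *\<^sub>R (M i *v (h *\<^sub>R w h))))
         + (\<Sum>i<3. h ^ i *\<^sub>R (\<mu> i *\<^sub>R (M i *v (h *\<^sub>R (w h - P h)))))
         + (h ^ 4 *\<^sub>R ((c * \<mu> 1) *\<^sub>R (A *v v2) + (c\<^sup>2 * \<mu> 2) *\<^sub>R (A *v (A *v v1)))
      + h ^ 5 *\<^sub>R ((c\<^sup>2 * \<mu> 2) *\<^sub>R (A *v (A *v v2)))))"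
    by (rule vanishes_add[OF vanishes_add[OF psi_error argument_error] high_powers])
  also have "(\<lambda>h. (psi p j (h *\<^sub>R (c *\<^sub>R A)) *v (h *\<^sub>R w h)
           - (\<Sum>i<3. (h ^ i * \<mu> i) *\<^sub>R (M i *v (h *\<^sub>R w h))))
         + (\<Sum>i<3. h ^ i *\<^sub>R (\<mu> i *\<^sub>R (M i *v (h *\<^sub>R (w h - P h)))))
         + (h ^ 4 *\<^sub>R ((c * \<mu> 1) *\<^sub>R (A *v v2) + (c\<^sup>2 * \<mu> 2) *\<^sub>R (A *v (A *v v1)))
      + h ^ 5 *\<^sub>R ((c\<^sup>2 * \<mu> 2) *\<^sub>R (A *v (A *v v2)))))
    = (\<lambda>h. psi p j (h *\<^sub>R (c *\<^sub>R A)) *v (h *\<^sub>R w h)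
           - (\<Sum>i<3. (h ^ i * \<mu> i) *\<^sub>R (M i *v (h *\<^sub>R P h)))
         + (h ^ 4 *\<^sub>R ((c * \<mu> 1) *\<^sub>R (A *v v2) + (c\<^sup>2 * \<mu> 2) *\<^sub>R (A *v (A *v v1)))
      + h ^ 5 *\<^sub>R ((c\<^sup>2 * \<mu> 2) *\<^sub>R (A *v (A *v v2)))))"
    by (simp add: scaleR_diff_right matrix_vector_mult_diff_distrib sum_subtractf)
  also have "\<dots> = (\<lambda>h. psi p j (h *\<^sub>R (c *\<^sub>R A)) *v (h *\<^sub>R w h)
           - (h *\<^sub>R (\<mu> 0 *\<^sub>R v0)
            + h\<^sup>2 *\<^sub>R (\<mu> 0 *\<^sub>R v1 + (c * \<mu> 1) *\<^sub>R (A *v v0))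
            + h ^ 3 *\<^sub>R (\<mu> 0 *\<^sub>R v2 + (c * \<mu> 1) *\<^sub>R (A *v v1)
                + (c\<^sup>2 * \<mu> 2) *\<^sub>R (A *v (A *v v0)))))"
    by (simp add: P_def numeral_3_eq_3 M[unfolded numeral_2_eq_2] eval_nat_numeral algebra_simps)
  finally show ?thesis
    by (simp add: \<mu>_def mult.commute)
qed

text \<open>The variant for the internal stages. It admits an error \<open>O(h\<^sup>2)\<close> in \<open>w\<close>, which contributes only
\<open>O(h\<^sup>3)\<close>; the main part is covered by the third-order expansion.\<close>
lemma psi_second_order_expansion:
  fixes A :: "real^'n^'n"
  assumes w: "vanishes 2 (\<lambda>h. w h - (v0 + h *\<^sub>R v1))"
  shows "vanishes 3 (\<lambda>h. psi p j ((c * h) *\<^sub>R A) *v (h *\<^sub>R w h)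
           - (h *\<^sub>R (psi_coeff p j 0 *\<^sub>R v0)
            + h\<^sup>2 *\<^sub>R (psi_coeff p j 0 *\<^sub>R v1 + (c * psi_coeff p j 1) *\<^sub>R (A *v v0))))"
proof -
  define \<delta> where "\<delta> = (\<lambda>h. w h - (v0 + h *\<^sub>R v1))"
  have "vanishes (0 + Suc 2) (\<lambda>h. psi p j (h *\<^sub>R (c *\<^sub>R A)) *v (h *\<^sub>R \<delta> h)
      - (\<Sum>i<0. (h ^ i * psi_coeff p j i) *\<^sub>R (mat_power (c *\<^sub>R A) i *v (h *\<^sub>R \<delta> h))))"
    using w unfolding \<delta>_def by (intro psi_vector_expansion vanishes_step_scaleR)
  then have error: "vanishes 3 (\<lambda>h. psi p j ((c * h) *\<^sub>R A) *v (h *\<^sub>R \<delta> h))"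
    by (simp add: numeral_3_eq_3 numeral_2_eq_2 mult.commute)
  let ?u = "psi_coeff p j 0 *\<^sub>R 0 + (c * psi_coeff p j 1) *\<^sub>R (A *v v1)
      + (c\<^sup>2 * psi_coeff p j 2) *\<^sub>R (A *v (A *v v0))"
  have "vanishes 3 (\<lambda>h. (v0 + h *\<^sub>R v1) - (v0 + h *\<^sub>R v1 + h\<^sup>2 *\<^sub>R 0))"
    by simp
  from vanishes_mono[OF psi_third_order_expansion[OF this], of 3 p j c A]
  have main: "vanishes 3 (\<lambda>h. psi p j ((c * h) *\<^sub>R A) *v (h *\<^sub>R (v0 + h *\<^sub>R v1))
           - (h *\<^sub>R (psi_coeff p j 0 *\<^sub>R v0)
            + h\<^sup>2 *\<^sub>R (psi_coeff p j 0 *\<^sub>R v1 + (c * psi_coeff p j 1) *\<^sub>R (A *v v0))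
            + h ^ 3 *\<^sub>R ?u))"
    by simp
  have split: "psi p j ((c * h) *\<^sub>R A) *v (h *\<^sub>R w h)
      = psi p j ((c * h) *\<^sub>R A) *v (h *\<^sub>R (v0 + h *\<^sub>R v1)) + psi p j ((c * h) *\<^sub>R A) *v (h *\<^sub>R \<delta> h)" for h
    by (simp add: \<delta>_def flip: matrix_vector_right_distrib scaleR_add_right)
  from vanishes_add[OF vanishes_add[OF main error] vanishes_monomial[of 3 3 ?u]]
  show ?thesis
    unfolding split by (simp add: diff_add_eq add_diff_eq diff_diff_eq add.assoc add.commute add.left_commute)
qed

text \<open>The abbreviations name the expansion coefficients of the internal stages:
\<open>Y\<^sub>1 - y\<^sub>n = h c1 F + h\<^sup>2 \<gamma>1 AF + O(h\<^sup>3)\<close> and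
\<open>Y\<^sub>2 - y\<^sub>n = h c2 F + h\<^sup>2 (\<gamma>2 AF + \<kappa> KF) + O(h\<^sup>3)\<close>.\<close>
locale epirkw_expansion = quadratic_model J B f yn
  for J :: "real^'n \<Rightarrow> real^'n" and B f and yn :: "real^'n" +
  fixes A :: "real^'n^'n"
    and a g p :: "nat \<Rightarrow> nat \<Rightarrow> real"
begin

abbreviation "F \<equiv> f yn"
abbreviation "K v \<equiv> J v - A *v v"
abbreviation "r \<equiv> rem f A yn"
abbreviation "\<mu> \<equiv> psi_coeff p"
abbreviation "Y h i \<equiv> epirkw_stages a g p f A yn h i"

abbreviation "c1 \<equiv> a 1 1 * \<mu> 1 0"
abbreviation "c2 \<equiv> a 2 1 * \<mu> 1 0"
abbreviation "\<gamma>1 \<equiv> a 1 1 * (g 1 1 * \<mu> 1 1)"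
abbreviation "\<gamma>2 \<equiv> a 2 1 * (g 2 1 * \<mu> 1 1)"
abbreviation "\<kappa> \<equiv> a 2 2 * (\<mu> 2 0 * c1)"

abbreviation "D1 h \<equiv> r (Y h 1) - r yn"
abbreviation "D2 h \<equiv> r (Y h 2) - r (Y h 1) - (r (Y h 1) - r yn)"

lemma forward_differences:
  "fdiff 1 s 0 = s 1 - s 0" "fdiff 2 s 0 = s 2 - s 1 - (s 1 - s 0)"
  by (simp_all add: numeral_2_eq_2)

lemma stage_0: "Y h 0 = yn"
  by (simp add: epirkw_stages_def Let_def)

lemma stage_1: "Y h 1 = yn + a 1 1 *\<^sub>R (psi p 1 ((g 1 1 * h) *\<^sub>R A) *v (h *\<^sub>R F))"
  by (simp add: epirkw_stages_def Let_def)

lemma stage_2: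
  "Y h 2 = yn + (a 2 1 *\<^sub>R (psi p 1 ((g 2 1 * h) *\<^sub>R A) *v (h *\<^sub>R F))
              + a 2 2 *\<^sub>R (psi p 2 ((g 2 2 * h) *\<^sub>R A) *v (h *\<^sub>R D1 h)))"
  by (simp add: epirkw_stages_def Let_def add.assoc)

lemma remainder_expansion:
  assumes "vanishes 3 (\<lambda>h. d h - (h *\<^sub>R e1 + h\<^sup>2 *\<^sub>R e2))"
  shows "vanishes 3 (\<lambda>h. r (yn + d h) - r yn
           - (h *\<^sub>R K e1 + h\<^sup>2 *\<^sub>R (K e2 + (1/2) *\<^sub>R B e1 e1)))"
proof -
  have "vanishes 3 (\<lambda>h. A *v (d h - (h *\<^sub>R e1 + h\<^sup>2 *\<^sub>R e2)))"
    by (rule vanishes_bounded_linear[OF matrix_vector_mul_bounded_linear assms])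
  from vanishes_diff[OF function_expansion[OF assms] this] show ?thesis
    by (simp add: rem_def algebra_simps)
qed

lemma D1_expansion:
  "vanishes 3 (\<lambda>h. D1 h - (h *\<^sub>R (c1 *\<^sub>R K F)
     + h\<^sup>2 *\<^sub>R (\<gamma>1 *\<^sub>R K (A *v F) + (c1\<^sup>2 / 2) *\<^sub>R B F F)))"
proof -
  have "vanishes 3 (\<lambda>h. a 1 1 *\<^sub>R (psi p 1 ((g 1 1 * h) *\<^sub>R A) *v (h *\<^sub>R F)
      - (h *\<^sub>R (\<mu> 1 0 *\<^sub>R F) + h\<^sup>2 *\<^sub>R (\<mu> 1 0 *\<^sub>R 0 + (g 1 1 * \<mu> 1 1) *\<^sub>R (A *v F)))))"
    by (intro vanishes_scaleR psi_second_order_expansion) simp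
  then have "vanishes 3 (\<lambda>h. a 1 1 *\<^sub>R (psi p 1 ((g 1 1 * h) *\<^sub>R A) *v (h *\<^sub>R F))
      - (h *\<^sub>R (c1 *\<^sub>R F) + h\<^sup>2 *\<^sub>R (\<gamma>1 *\<^sub>R (A *v F))))"
    by (simp add: algebra_simps)
  from remainder_expansion[OF this] show ?thesis
    unfolding stage_1
    by (simp add: J.scaleR B.scaleR_left B.scaleR_right algebra_simps power2_eq_square)
qed

text \<open>The second difference is \<open>r(Y\<^sub>2) - 2 r(Y\<^sub>1) + r(y\<^sub>n)\<close>. Its \<open>h\<close>-term is a multiple of \<open>c2 - 2 c1\<close>, which
is zero for \<open>a\<^sub>1\<^sub>1 = a\<^sub>2\<^sub>1/2\<close>.\<close>
lemma D2_expansion: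
  "vanishes 3 (\<lambda>h. D2 h - (h *\<^sub>R ((c2 - 2 * c1) *\<^sub>R K F)
     + h\<^sup>2 *\<^sub>R ((\<gamma>2 - 2 * \<gamma>1) *\<^sub>R K (A *v F) + \<kappa> *\<^sub>R K (K F)
           + ((c2\<^sup>2 - 2 * c1\<^sup>2) / 2) *\<^sub>R B F F)))"
proof -
  have "vanishes 2 (\<lambda>h. (D1 h - (h *\<^sub>R (c1 *\<^sub>R K F)
     + h\<^sup>2 *\<^sub>R (\<gamma>1 *\<^sub>R K (A *v F) + (c1\<^sup>2 / 2) *\<^sub>R B F F)))
     + h\<^sup>2 *\<^sub>R (\<gamma>1 *\<^sub>R K (A *v F) + (c1\<^sup>2 / 2) *\<^sub>R B F F))"
    by (intro vanishes_add vanishes_mono[OF D1_expansion] vanishes_monomial) auto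
  then have "vanishes 2 (\<lambda>h. D1 h - (0 + h *\<^sub>R (c1 *\<^sub>R K F)))"
    by (simp only: diff_diff_eq[symmetric] diff_add_cancel diff_zero)
  then have "vanishes 3 (\<lambda>h.
      a 2 1 *\<^sub>R (psi p 1 ((g 2 1 * h) *\<^sub>R A) *v (h *\<^sub>R F)
        - (h *\<^sub>R (\<mu> 1 0 *\<^sub>R F) + h\<^sup>2 *\<^sub>R (\<mu> 1 0 *\<^sub>R 0 + (g 2 1 * \<mu> 1 1) *\<^sub>R (A *v F))))
      + a 2 2 *\<^sub>R (psi p 2 ((g 2 2 * h) *\<^sub>R A) *v (h *\<^sub>R D1 h)
        - (h *\<^sub>R (\<mu> 2 0 *\<^sub>R 0)
          + h\<^sup>2 *\<^sub>R (\<mu> 2 0 *\<^sub>R (c1 *\<^sub>R K F) + (g 2 2 * \<mu> 2 1) *\<^sub>R (A *v 0)))))"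
    by (intro vanishes_add vanishes_scaleR psi_second_order_expansion) simp_all
  then have "vanishes 3 (\<lambda>h.
      (a 2 1 *\<^sub>R (psi p 1 ((g 2 1 * h) *\<^sub>R A) *v (h *\<^sub>R F))
        + a 2 2 *\<^sub>R (psi p 2 ((g 2 2 * h) *\<^sub>R A) *v (h *\<^sub>R D1 h)))
      - (h *\<^sub>R (c2 *\<^sub>R F) + h\<^sup>2 *\<^sub>R (\<gamma>2 *\<^sub>R (A *v F) + \<kappa> *\<^sub>R K F)))"
    by (simp add: algebra_simps)
  from remainder_expansion[OF this]
  have "vanishes 3 (\<lambda>h. r (Y h 2) - r yn - (h *\<^sub>R K (c2 *\<^sub>R F)
      + h\<^sup>2 *\<^sub>R (K (\<gamma>2 *\<^sub>R (A *v F) + \<kappa> *\<^sub>R K F) + (1/2) *\<^sub>R B (c2 *\<^sub>R F) (c2 *\<^sub>R F))))"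
    unfolding stage_2 .
  note stage_2_expansion = this
  have D2: "D2 h = (r (Y h 2) - r yn) - 2 *\<^sub>R D1 h" for h
    by (simp add: scaleR_2)
  from vanishes_diff[OF stage_2_expansion vanishes_scaleR[OF D1_expansion, of 2]]
  show ?thesis
    unfolding D2
    by (rule back_subst[of "vanishes 3", OF _ ext])
      (simp add: J.scaleR J.add J.diff B.scaleR_left B.scaleR_right power2_eq_square
        matrix_vector_right_distrib matrix_vector_mult_diff_distrib matrix_vector_mult_scaleR,
       simp add: algebra_simps add_divide_distrib diff_divide_distrib)
qed

lemma step_expansion:
  assumes g3: "g 3 1 = 1" "g 3 2 = 1" "g 3 3 = 1"
  shows "vanishes 4 (\<lambda>h. epirkw_step a b g p f A yn h - (yn
    + h *\<^sub>R ((b 1 * \<mu> 1 0) *\<^sub>R F)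
    + h\<^sup>2 *\<^sub>R ((b 1 * \<mu> 1 1) *\<^sub>R (A *v F)
        + (b 2 * \<mu> 2 0 * c1 + b 3 * \<mu> 3 0 * (c2 - 2 * c1)) *\<^sub>R K F)
    + h ^ 3 *\<^sub>R ((b 1 * \<mu> 1 2) *\<^sub>R (A *v (A *v F))
        + (b 2 * \<mu> 2 1 * c1 + b 3 * \<mu> 3 1 * (c2 - 2 * c1)) *\<^sub>R (A *v K F)
        + (b 2 * \<mu> 2 0 * \<gamma>1 + b 3 * \<mu> 3 0 * (\<gamma>2 - 2 * \<gamma>1)) *\<^sub>R K (A *v F)
        + (b 3 * \<mu> 3 0 * \<kappa>) *\<^sub>R K (K F)
        + ((b 2 * \<mu> 2 0 * c1\<^sup>2 + b 3 * \<mu> 3 0 * (c2\<^sup>2 - 2 * c1\<^sup>2)) / 2) *\<^sub>R B F F)))"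
proof -
  have step: "epirkw_step a b g p f A yn h = yn
      + b 1 *\<^sub>R (psi p 1 ((1 * h) *\<^sub>R A) *v (h *\<^sub>R F))
      + b 2 *\<^sub>R (psi p 2 ((1 * h) *\<^sub>R A) *v (h *\<^sub>R D1 h))
      + b 3 *\<^sub>R (psi p 3 ((1 * h) *\<^sub>R A) *v (h *\<^sub>R D2 h))" for h
    by (simp only: epirkw_step_def Let_def g3 forward_differences o_def stage_0)
  have e1: "vanishes 3 (\<lambda>h. F - (F + h *\<^sub>R 0 + h\<^sup>2 *\<^sub>R 0))"
    by simp
  have e2: "vanishes 3 (\<lambda>h. D1 h - (0 + h *\<^sub>R (c1 *\<^sub>R K F)
     + h\<^sup>2 *\<^sub>R (\<gamma>1 *\<^sub>R K (A *v F) + (c1\<^sup>2 / 2) *\<^sub>R B F F)))"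
    using D1_expansion by simp
  have e3: "vanishes 3 (\<lambda>h. D2 h - (0 + h *\<^sub>R ((c2 - 2 * c1) *\<^sub>R K F)
     + h\<^sup>2 *\<^sub>R ((\<gamma>2 - 2 * \<gamma>1) *\<^sub>R K (A *v F) + \<kappa> *\<^sub>R K (K F)
           + ((c2\<^sup>2 - 2 * c1\<^sup>2) / 2) *\<^sub>R B F F)))"
    using D2_expansion by simp
  note vanishes_add[OF vanishes_add[OF
      vanishes_scaleR[OF psi_third_order_expansion[OF e1, of p 1 1 A], of "b 1"]
      vanishes_scaleR[OF psi_third_order_expansion[OF e2, of p 2 1 A], of "b 2"]]
      vanishes_scaleR[OF psi_third_order_expansion[OF e3, of p 3 1 A], of "b 3"]]
  then show ?thesis
    unfolding step
    by (rule back_subst[of "vanishes 4", OF _ ext])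
      (simp add: matrix_vector_mult_scaleR,
       simp add: algebra_simps add_divide_distrib diff_divide_distrib)
qed

section \<open>Order conditions\<close>

context
  fixes b :: "nat \<Rightarrow> real" and y :: "real \<Rightarrow> real^'n" and tn T :: real
  assumes cont: "continuous_on UNIV f" and T: "T > 0" and init: "y tn = yn"
    and ode: "\<And>t. t \<in> {tn..tn + T} \<Longrightarrow>
                (y has_vector_derivative f (y t)) (at t within {tn..tn + T})"
    and g3: "g 3 1 = 1" "g 3 2 = 1" "g 3 3 = 1"
    and order_1: "b 1 * \<mu> 1 0 = 1"
    and order_2: "b 1 * \<mu> 1 1 = 1/2"
      "b 2 * \<mu> 2 0 * c1 + b 3 * \<mu> 3 0 * (c2 - 2 * c1) = 1/2"
begin

lemma local_error_order_two:
  "vanishes 3 (\<lambda>h. epirkw_step a b g p f A yn h - y (tn + h))"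
proof -
  have first: "(1/2) *\<^sub>R (A *v F) + (1/2) *\<^sub>R K F = (1/2) *\<^sub>R J F"
    by (simp add: algebra_simps)
  have truncate: "vanishes 3 (\<lambda>h. X h - P h)"
    if "vanishes 4 (\<lambda>h. X h - (P h + h ^ 3 *\<^sub>R v))" for X P :: "real \<Rightarrow> real^'n" and v
    using vanishes_add[OF vanishes_mono[OF that, of 3] vanishes_monomial[of 3 3 v]] by simp
  note step = step_expansion[OF g3, of b, unfolded order_1 order_2 first]
  note exact = exact_solution_expansion[OF cont T init ode]
  from vanishes_diff[OF truncate[OF step] truncate[OF exact]] show ?thesis
    by simp
qed

text \<open>The five weights of the cubic term are those of \<open>AAF\<close>, \<open>AKF\<close>, \<open>KAF\<close>, \<open>KKF\<close> and \<open>B(F,F)\<close>. The last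
one is \<open>1/3\<close> because the quadratic model carries \<open>B\<close> with the factor \<open>1/2\<close>.\<close>
lemma local_error_order_three:
  assumes order_3: "b 1 * \<mu> 1 2 = 1/6"
      "b 2 * \<mu> 2 1 * c1 + b 3 * \<mu> 3 1 * (c2 - 2 * c1) = 1/6"
      "b 2 * \<mu> 2 0 * \<gamma>1 + b 3 * \<mu> 3 0 * (\<gamma>2 - 2 * \<gamma>1) = 1/6"
      "b 3 * \<mu> 3 0 * \<kappa> = 1/6"
      "b 2 * \<mu> 2 0 * c1\<^sup>2 + b 3 * \<mu> 3 0 * (c2\<^sup>2 - 2 * c1\<^sup>2) = 1/3"
  shows "vanishes 4 (\<lambda>h. epirkw_step a b g p f A yn h - y (tn + h))"
proof -
  have first: "(1/2) *\<^sub>R (A *v F) + (1/2) *\<^sub>R K F = (1/2) *\<^sub>R J F"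
    by (simp add: algebra_simps)
  have second: "(1/6) *\<^sub>R (A *v (A *v F)) + (1/6) *\<^sub>R (A *v K F) + (1/6) *\<^sub>R K (A *v F)
      + (1/6) *\<^sub>R K (K F) + (1/3/2) *\<^sub>R B F F = (1/6) *\<^sub>R (J (J F) + B F F)"
    by (simp add: J.diff algebra_simps)
  note step = step_expansion[OF g3, of b, unfolded order_1 order_2 order_3 first second scaleR_one]
  note exact = exact_solution_expansion[OF cont T init ode]
  from vanishes_diff[OF step exact] show ?thesis
    by simp
qed

end

end

section \<open>Order of the three-stage method\<close>

lemma smooth_imp_quadratic_model:
  fixes f :: "'a::euclidean_space \<Rightarrow> 'a"
  assumes "smooth f"
  obtains J B where "quadratic_model J B f x"
proof -
  have "k_times_differentiable 3 f"
    using assms by (simp add: smooth_def)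
  then obtain J B where "bounded_linear J" "bounded_bilinear B"
    "(\<lambda>d. norm (f (x + d) - f x - J d - (1/2) *\<^sub>R B d d)) \<in> O[nhds 0](\<lambda>d. norm d ^ 3)"
    by (rule taylor_second_order)
  then have "quadratic_model J B f x"
    by (simp add: quadratic_model_def quadratic_model_axioms_def)
  then show ?thesis by (rule that)
qed

theorem mainTheorem2:
  fixes a g p :: "nat \<Rightarrow> nat \<Rightarrow> real" and b :: "nat \<Rightarrow> real"
  assumes nz1: "3 * a 2 1 * p 1 1 - 4 \<noteq> 0"
    and nz2: "3 * a 1 1 * a 2 2 * (3 * a 2 1 * p 1 1 - 4) \<noteq> 0"
    and nz3: "p 1 1 \<noteq> 0"
    and nz4: "2 * (a 2 1)^2 * (p 1 1)^2 \<noteq> 0"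
    and nz5: "(a 2 1)^2 * (p 1 1)^2 * (6 * p 3 1 + 3 * p 3 2 + p 3 3) \<noteq> 0"
    and g3: "g 3 1 = 1" "g 3 2 = 1" "g 3 3 = 1"
    and g21: "g 2 1 = 2 * (3 * a 2 1 * g 1 1 * p 1 1 - a 2 1 * p 1 1 - 2 * g 1 1)
                        / (3 * a 2 1 * p 1 1 - 4)"
    and g22: "g 2 2 = 2 * (3 * a 2 1 * g 1 1 * p 1 1 - a 2 1 * p 1 1 - 2 * g 1 1)
                        / (3 * a 2 1 * p 1 1 - 4)"
    and a11: "a 1 1 = a 2 1 / 2"
    and p21: "p 2 1 = 0"
    and p22: "p 2 2 = - (2 * (9 * a 1 1 * a 2 1 * a 2 2 * p 1 1 * p 2 1 - 6 * a 1 1 * a 2 1 * p 1 1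
                                - 12 * a 1 1 * a 2 2 * p 2 1 + 8 * a 1 1
                                + 6 * (a 2 1)^2 * p 1 1 - 4 * a 2 1)
                           / (3 * a 1 1 * a 2 2 * (3 * a 2 1 * p 1 1 - 4)))"
    and b1: "b 1 = 1 / p 1 1"
    and b2: "b 2 = - (a 2 2 * (3 * a 2 1 * p 1 1 - 4) / (2 * (a 2 1)^2 * (p 1 1)^2))"
    and b3: "b 3 = - ((3 * a 2 1 * p 1 1 - 4)
                        / ((a 2 1)^2 * (p 1 1)^2 * (6 * p 3 1 + 3 * p 3 2 + p 3 3)))"
  shows "epirkw_order TYPE('n::finite) a b g p 3 \<and>
         (\<forall>bh :: nat \<Rightarrow> real. bh 1 = b 1 \<and> bh 2 = b 2 \<longrightarrow>
            epirkw_order TYPE('n) a bh g p 2)"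
proof -
  \<comment> \<open>All order conditions depend on the coefficients through \<open>x\<close> and \<open>g 1 1\<close> only.\<close>
  define x where "x = a 2 1 * p 1 1"
  have nz: "a 2 1 \<noteq> 0" "a 2 2 \<noteq> 0" "p 1 1 \<noteq> 0" "3 * x - 4 \<noteq> 0" "x \<noteq> 0"
    "6 * p 3 1 + 3 * p 3 2 + p 3 3 \<noteq> 0"
    using nz1 nz2 nz3 nz4 nz5 by (auto simp: x_def mult.assoc)
  have \<mu>1: "psi_coeff p 1 0 = p 1 1" "psi_coeff p 1 1 = p 1 1 / 2" "psi_coeff p 1 2 = p 1 1 / 6"
    and \<mu>2: "psi_coeff p 2 0 = p 2 2 / 2" "psi_coeff p 2 1 = p 2 2 / 6"
    and \<mu>3: "psi_coeff p 3 0 = (6 * p 3 1 + 3 * p 3 2 + p 3 3) / 6"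
    by (simp_all add: psi_coeff_def p21[unfolded numeral_2_eq_2 One_nat_def] numeral_2_eq_2 numeral_3_eq_3 field_simps)
  have c: "a 1 1 * psi_coeff p 1 0 = x / 2" "a 2 1 * psi_coeff p 1 0 = x"
    unfolding \<mu>1 x_def a11 by simp_all
  have b1': "b 1 * psi_coeff p 1 0 = 1" "b 1 * psi_coeff p 1 1 = 1/2" "b 1 * psi_coeff p 1 2 = 1/6"
    unfolding \<mu>1 b1 using nz by simp_all
  have p22': "p 2 2 = - (4 * x / (a 2 2 * (3 * x - 4)))"
    using nz nz1 unfolding p22 p21 a11 x_def by (simp add: divide_simps) algebra
  have b2': "b 2 * psi_coeff p 2 0 = 1 / x" "b 2 * psi_coeff p 2 1 = 1 / (3 * x)"
  proof -
    have eq: "b 2 = - (a 2 2 * (3 * x - 4) / (2 * x\<^sup>2))"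
      unfolding b2 x_def by (simp add: power_mult_distrib mult.assoc)
    show "b 2 * psi_coeff p 2 0 = 1 / x" "b 2 * psi_coeff p 2 1 = 1 / (3 * x)"
      unfolding eq \<mu>2 p22' using nz by (simp_all add: divide_simps power2_eq_square)
  qed
  have b3': "b 3 * psi_coeff p 3 0 = - ((3 * x - 4) / (6 * x\<^sup>2))"
    using nz unfolding b3 \<mu>3 by (simp add: x_def divide_simps)
  have \<gamma>1: "a 1 1 * (g 1 1 * psi_coeff p 1 1) = x * g 1 1 / 4"
    unfolding \<mu>1 a11 x_def by simp
  have \<gamma>2: "a 2 1 * (g 2 1 * psi_coeff p 1 1) - 2 * (x * g 1 1 / 4)
      = x * (3 * x * g 1 1 - 2 * x) / (2 * (3 * x - 4))"
    using nz nz1 unfolding \<mu>1 g21 x_def by (simp add: divide_simps) algebra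
  have \<kappa>: "a 2 2 * (psi_coeff p 2 0 * (x / 2)) = - (x\<^sup>2 / (3 * x - 4))"
    using nz unfolding \<mu>2 p22' by (simp add: divide_simps) algebra
  have order_2: "bh 2 * psi_coeff p 2 0 * (x / 2) + bh 3 * psi_coeff p 3 0 * (x - 2 * (x / 2)) = 1/2"
    if "bh 2 = b 2" for bh :: "nat \<Rightarrow> real"
    unfolding that b2' using nz by simp
  have AKF: "b 2 * psi_coeff p 2 1 * (x / 2) + b 3 * psi_coeff p 3 1 * (x - 2 * (x / 2)) = 1/6"
    unfolding b2' using nz by simp
  have KAF: "b 2 * psi_coeff p 2 0 * (x * g 1 1 / 4)
      + b 3 * psi_coeff p 3 0 * (a 2 1 * (g 2 1 * psi_coeff p 1 1) - 2 * (x * g 1 1 / 4)) = 1/6"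
    unfolding \<gamma>2 b2' b3' using nz
    by (simp add: divide_simps power2_eq_square) (simp add: algebra_simps)
  have KKF: "b 3 * psi_coeff p 3 0 * (a 2 2 * (psi_coeff p 2 0 * (x / 2))) = 1/6"
    unfolding \<kappa> b3' using nz by (simp add: divide_simps power2_eq_square)
  have BFF: "b 2 * psi_coeff p 2 0 * (x / 2)\<^sup>2
      + b 3 * psi_coeff p 3 0 * (x\<^sup>2 - 2 * (x / 2)\<^sup>2) = 1/3"
    unfolding b2' b3' using nz
    by (simp add: divide_simps power2_eq_square)
  have solution: "vanishes 4 (\<lambda>h. epirkw_step a b g p f A yn h - y (tn + h)) \<and>
      (\<forall>bh. bh 1 = b 1 \<and> bh 2 = b 2 \<longrightarrow>
        vanishes 3 (\<lambda>h. epirkw_step a bh g p f A yn h - y (tn + h)))"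
    if f: "smooth f" and T: "T > 0" and init: "y tn = yn"
      and ode: "\<forall>t\<in>{tn..tn + T}. (y has_vector_derivative f (y t)) (at t within {tn..tn + T})"
    for f :: "real^'n \<Rightarrow> real^'n" and A yn y tn T
  proof -
    obtain J B where "quadratic_model J B f yn"
      using f by (rule smooth_imp_quadratic_model)
    then interpret epirkw_expansion J B f yn A a g p
      by (rule epirkw_expansion.intro)
    have cont: "continuous_on UNIV f"
      using f unfolding smooth_def by (metis k_times_differentiable.simps(1))
    note data = cont T init bspec[OF ode] g3
    have "vanishes 3 (\<lambda>h. epirkw_step a bh g p f A yn h - y (tn + h))"
      if "bh 1 = b 1" "bh 2 = b 2" for bh
      using b1' order_2[of bh] that by (intro local_error_order_two[OF data]) (simp_all only: c)
    moreover have "vanishes 4 (\<lambda>h. epirkw_step a b g p f A yn h - y (tn + h))"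
      using b1' order_2[of b] AKF KAF KKF BFF
      by (intro local_error_order_three[OF data]) (simp_all only: c \<gamma>1)
    ultimately show ?thesis by blast
  qed
  then show ?thesis
    unfolding epirkw_order_def vanishes_def by simp
qed

end
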